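(* Let $f\in\mathcal{S}$ and let $\gamma_3,\gamma_4$ be its logarithmic coefficients. Then $$|\gamma_4|-|\gamma_3|\le \frac{1}{\sqrt{7}}.$$
   Context: Let $\mathbb{D}=\{z\in\mathbb{C}:|z|<1\}$. $\mathcal{S}$ denotes the class of functions $f$ analytic and univalent in $\mathbb{D}$ with the normalization $f(z)=z+a_2z^2+a_3z^3+\cdots$ (i.e. $f(0)=0$, $f'(0)=1$). The logarithmic coefficients $\gamma_n$ of $f\in\mathcal{S}$ are defined by $$\log\frac{f(z)}{z}=2\sum_{n=1}^{\infty}\gamma_n z^n,\qquad z\in\mathbb{D},$$ where the branch of the logarithm is the one equal to $0$ at $z=0$. In particular $\gamma_3=\tfrac12\left(a_4-a_2a_3+\tfrac13a_2^3\right)$ and $\gamma_4=\tfrac12\left(a_5-a_2a_4-\tfrac12a_3^2+a_2^2a_3-\tfrac14a_2^4\right)$. *)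

theory Defs
  imports "HOL-Complex_Analysis.Complex_Analysis"
begin

definition classS :: "(complex \<Rightarrow> complex) \<Rightarrow> bool" where
  "classS f \<longleftrightarrow> f holomorphic_on ball 0 1 \<and> inj_on f (ball 0 1) \<and> f 0 = 0 \<and> deriv f 0 = 1"

definition tcoeff :: "(complex \<Rightarrow> complex) \<Rightarrow> nat \<Rightarrow> complex" where
  "tcoeff f n = (deriv ^^ n) f 0 / of_nat (fact n)"

definition gamma3 :: "(complex \<Rightarrow> complex) \<Rightarrow> complex" where
  "gamma3 f = (let a2 = tcoeff f 2; a3 = tcoeff f 3; a4 = tcoeff f 4 in
     (a4 - a2 * a3 + a2 ^ 3 / 3) / 2)"

definition gamma4 :: "(complex \<Rightarrow> complex) \<Rightarrow> complex" where
  "gamma4 f = (let a2 = tcoeff f 2; a3 = tcoeff f 3; a4 = tcoeff f 4; a5 = tcoeff f 5 in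
     (a5 - a2 * a4 - a3 ^ 2 / 2 + a2 ^ 2 * a3 - a2 ^ 4 / 4) / 2)"

end

theory Submission
  imports Defs
begin

text \<open>
  Let \<open>e\<close> be the branch of \<open>sqrt (z / f z)\<close> with \<open>e 0 = 1\<close>, with Taylor coefficients \<open>e\<^sub>n\<close>. Since \<open>f\<close> is
  univalent, so is the odd function \<open>e (z\<^sup>2) / z = 1/z + e\<^sub>1 z + e\<^sub>2 z\<^sup>3 + e\<^sub>3 z\<^sup>5 + e\<^sub>4 z\<^sup>7 + \<dots>\<close>,
  and Gronwall's area theorem gives
  \<open>\<bar>e\<^sub>1\<bar>\<^sup>2 + 3 \<bar>e\<^sub>2\<bar>\<^sup>2 + 5 \<bar>e\<^sub>3\<bar>\<^sup>2 + 7 \<bar>e\<^sub>4\<bar>\<^sup>2 \<le> 1\<close>. On the other hand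
  \<open>\<gamma>\<^sub>4 + e\<^sub>1 \<gamma>\<^sub>3 = - e\<^sub>4 + e\<^sub>2\<^sup>2 / 2 - e\<^sub>1\<^sup>4 / 12\<close>, and \<open>\<bar>e\<^sub>1\<bar> \<le> 1\<close>; the rest is an elementary inequality.

  The area theorem is obtained by comparing the area of the image of an annulus \<open>\<rho> < \<bar>z\<bar> < r\<close>, computed by
  change of variables and bounded below by Bessel's inequality on circles, with that of an
  ellipse which encloses the image, as \<open>\<rho> \<rightarrow> 0\<close> and \<open>r \<rightarrow> 1\<close>.
\<close>

no_notation fps_nth (infixl "$" 75)

subsection \<open>Bessel's inequality on circles\<close>

lemma has_fps_expansion_divide_power:
  fixes f :: "complex \<Rightarrow> complex"
  assumes f: "f has_fps_expansion F" and zero: "\<And>i. i < n \<Longrightarrow> fps_nth F i = 0"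
  shows "(\<lambda>z. if z = 0 then fps_nth F n else f z / z ^ n) has_fps_expansion fps_shift n F"
proof (cases "F = 0")
  \<comment> \<open>The zero series has subdegree 0, so \<open>n \<le> subdegree F\<close> can fail
    here and this case is treated apart.\<close>
  case True
  with f have "eventually (\<lambda>z. f z = 0) (nhds 0)"
    by (simp add: has_fps_expansion_0_iff)
  then have "eventually (\<lambda>z. (if z = 0 then fps_nth F n else f z / z ^ n) = 0) (nhds 0)"
    by eventually_elim (simp add: True)
  then show ?thesis by (simp add: True has_fps_expansion_0_iff)
next
  case False
  then have "n \<le> subdegree F" using zero by (intro subdegree_geI) auto
  with f show ?thesis by (intro has_fps_expansion_shift) auto
qed

text \<open>Up to the factor \<open>\<i>\<close> this is the contour integral of \<open>g\<close>
  over the circle, which vanishes by Cauchy's theorem.\<close>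

lemma integral_circle_eq_0:
  fixes g :: "complex \<Rightarrow> complex"
  assumes "g holomorphic_on ball 0 R" "0 < r" "r < R"
  shows "integral {0..2*pi} (\<lambda>t. (of_real r * cis t) * g (of_real r * cis t)) = 0"
proof -
  have "(g has_contour_integral 0) (part_circlepath 0 r 0 (2*pi))"
  proof (rule Cauchy_theorem_disc_simple[OF assms(1)])
    show "path_image (part_circlepath 0 r 0 (2*pi)) \<subseteq> ball 0 R"
      using assms by (auto simp: path_image_part_circlepath' norm_mult)
  qed (use assms in \<open>auto simp: simp: exp_eq_polar\<close>)
  then have "integral {0..2*pi} (\<lambda>t. g (of_real r * cis t) * r * \<i> * cis t) = 0"
    using contour_integral_unique contour_integral_part_circlepath_eq[of 0 "2*pi" 0 r g] by simp
  moreover have "integral {0..2*pi} (\<lambda>t. g (of_real r * cis t) * r * \<i> * cis t)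
     = integral {0..2*pi} (\<lambda>t. \<i> * ((of_real r * cis t) * g (of_real r * cis t)))"
    by (simp add: mult_ac)
  ultimately show ?thesis by simp
qed

text \<open>Induction on \<open>N\<close>, splitting off the constant term as
  \<open>f z = c + z * g z\<close>. The cross term has mean zero by Cauchy's theorem, and the
  coefficients of \<open>g\<close> are those of \<open>f\<close> shifted by one.\<close>

lemma bessel_circle:
  fixes f :: "complex \<Rightarrow> complex"
  assumes "f holomorphic_on ball 0 R" "f has_fps_expansion F" "0 < r" "r < R"
  shows "2 * pi * (\<Sum>n<N. (norm (fps_nth F n))\<^sup>2 * r ^ (2*n))
           \<le> integral {0..2*pi} (\<lambda>t. (norm (f (of_real r * cis t)))\<^sup>2)"
proof -
  let ?z = "\<lambda>t. of_real r * cis t :: complex"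
  have zin: "?z t \<in> ball 0 R" for t using assms by (simp add: norm_mult)
  have cont: "continuous_on {0..2*pi} (\<lambda>t. g (?z t))" if "g holomorphic_on ball 0 R" for g
    by (rule continuous_on_compose2[OF holomorphic_on_imp_continuous_on[OF that]])
       (use zin in \<open>auto intro!: continuous_intros\<close>)
  show ?thesis
    using assms(1,2)
  proof (induction N arbitrary: f F)
    case 0
    have "(\<lambda>t. (norm (f (?z t)))\<^sup>2) integrable_on {0..2*pi}"
      by (intro integrable_continuous_interval continuous_intros cont 0)
    then show ?case by (auto intro!: integral_nonneg)
  next
    case (Suc N)
    define c where "c = fps_nth F 0"
    \<comment> \<open>The unsimplified quotient matches the form of \<open>pole_lemma\<close>, which
      gives holomorphy at 0.\<close>
    define g where "g = (\<lambda>z. if z = 0 then deriv f 0 else (f z - f 0) / (z - 0))"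
    have c: "f 0 = c"
      unfolding c_def by (rule has_fps_expansion_imp_0_eq_fps_nth_0[OF Suc.prems(2)])
    have R: "0 < R" using assms by simp
    have g_hol: "g holomorphic_on ball 0 R"
      unfolding g_def using pole_lemma[OF Suc.prems(1), of 0] R by simp
    have der: "deriv f 0 = fps_nth F 1"
      using has_fps_expansion_imp_0_eq_fps_nth_0[OF has_fps_expansion_deriv[OF Suc.prems(2)]] by simp
    have g_exp: "g has_fps_expansion fps_shift 1 F"
    proof -
      have "(\<lambda>z. f z - c) has_fps_expansion F - fps_const c"
        by (intro fps_expansion_intros Suc.prems)
      from has_fps_expansion_divide_power[OF this, of 1]
      have "(\<lambda>z. if z = 0 then fps_nth F 1 else (f z - c) / z) has_fps_expansion fps_shift 1 (F - fps_const c)"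
        by (simp add: c_def cong: if_cong)
      moreover have "fps_shift 1 (F - fps_const c) = fps_shift 1 F"
        by (rule fps_ext) simp
      moreover have "g = (\<lambda>z. if z = 0 then fps_nth F 1 else (f z - c) / z)"
        by (auto simp: g_def fun_eq_iff c der)
      ultimately show ?thesis by simp
    qed
    note cont_g = cont[OF g_hol]
    have f_eq: "f (?z t) = c + ?z t * g (?z t)" for t
      using assms by (auto simp: g_def c)
    define E where "E = (\<lambda>t. cnj c * (?z t * g (?z t)))"
    have expand: "(norm (f (?z t)))\<^sup>2
       = (norm c)\<^sup>2 + r\<^sup>2 * (norm (g (?z t)))\<^sup>2 + 2 * Re (E t)" for t
    proof -
      have "(norm (c + w))\<^sup>2 = (norm c)\<^sup>2 + (norm w)\<^sup>2 + 2 * Re (cnj c * w)" for w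
        unfolding cmod_power2 by (simp add: power2_eq_square algebra_simps)
      from this[of "?z t * g (?z t)"] show ?thesis
        unfolding f_eq by (simp add: norm_mult power_mult_distrib E_def)
    qed
    have int1: "(\<lambda>t. r\<^sup>2 * (norm (g (?z t)))\<^sup>2) integrable_on {0..2*pi}"
      by (intro integrable_continuous_interval continuous_intros cont_g)
    have E: "E integrable_on {0..2*pi}"
      unfolding E_def by (intro integrable_continuous_interval continuous_intros cont_g)
    have int2: "(\<lambda>t. 2 * Re (E t)) integrable_on {0..2*pi}"
      by (intro integrable_on_mult_right integrable_linear[OF E bounded_linear_Re, unfolded o_def])
    have "integral {0..2*pi} E = 0"
      unfolding E_def integral_mult_right integral_circle_eq_0[OF g_hol assms(3,4)] by simp
    then have reE: "integral {0..2*pi} (\<lambda>t. Re (E t)) = 0"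
      using integral_unique[OF has_integral_linear[OF integrable_integral[OF E] bounded_linear_Re]]
      by (metis (no_types, lifting) comp_apply ext zero_complex.sel(1))
    have "integral {0..2*pi} (\<lambda>t. (norm (f (?z t)))\<^sup>2)
        = 2 * pi * (norm c)\<^sup>2 + r\<^sup>2 * integral {0..2*pi} (\<lambda>t. (norm (g (?z t)))\<^sup>2)"
      unfolding expand 
      by (subst integral_add integral_add[OF _ int1] | intro integrable_add int1 int2 integrable_const_ivl | simp add: reE)+
    moreover have "r\<^sup>2 * integral {0..2*pi} (\<lambda>t. (norm (g (?z t)))\<^sup>2)
        \<ge> r\<^sup>2 * (2 * pi * (\<Sum>n<N. (norm (fps_nth F (Suc n)))\<^sup>2 * r ^ (2*n)))"
      using Suc.IH[OF g_hol g_exp] by (intro mult_left_mono) auto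
    moreover have "r\<^sup>2 * (2 * pi * (\<Sum>n<N. (norm (fps_nth F (Suc n)))\<^sup>2 * r ^ (2*n)))
       = 2 * pi * (\<Sum>n<N. (norm (fps_nth F (Suc n)))\<^sup>2 * r ^ (2*Suc n))"
      by (simp add: sum_distrib_left mult_ac power2_eq_square)
    ultimately show ?case
      unfolding sum.lessThan_Suc_shift by (simp add: c_def algebra_simps)
  qed
qed

subsection \<open>Area of holomorphic images of rectangles\<close>

text \<open>Iterated integrals are computed on \<open>real \<times> real\<close>, whereas the change
  of variables formula is applied on \<open>real^2\<close>; this carries integrals from one to the
  other, as the identification preserves the content of boxes.\<close>

lemma has_integral_vec2:
  fixes f :: "real \<times> real \<Rightarrow> real"
  assumes "(f has_integral i) (cbox (a, c) (b, d))"
  shows "((\<lambda>x::real^2. f (x$1, x$2)) has_integral i) (cbox (vector [a, c]) (vector [b, d]))"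
proof -
  let ?g = "\<lambda>x::real^2. (x$1, x$2)" and ?h = "\<lambda>p::real\<times>real. vector [fst p, snd p] :: real^2"
  have hg: "?h (?g x) = x" and gh: "?g (?h p) = p" for x p
    by (auto simp: vec_eq_iff forall_2)
  have mem: "p \<in> cbox u v \<longleftrightarrow> fst u \<le> fst p \<and> fst p \<le> fst v \<and> snd u \<le> snd p \<and> snd p \<le> snd v"
    for p u v :: "real \<times> real"
    by (cases p; cases u; cases v) (auto simp only: cbox_interval Pair_le atLeastAtMost_iff fst_conv snd_conv)
  have mem_h: "x \<in> cbox (?h u) (?h v) \<longleftrightarrow> ?g x \<in> cbox u v" for x u v
    unfolding mem mem_box_cart forall_2 vector_2 fst_conv snd_conv by blast
  have img_h: "?h ` cbox u v = cbox (?h u) (?h v)" for u v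
  proof (intro equalityI subsetI)
    fix x assume "x \<in> cbox (?h u) (?h v)"
    then have "?h (?g x) \<in> ?h ` cbox u v" unfolding mem_h by (rule imageI)
    then show "x \<in> ?h ` cbox u v" unfolding hg .
  next
    fix x assume "x \<in> ?h ` cbox u v"
    then obtain p where p: "p \<in> cbox u v" "x = ?h p" by (rule imageE)
    show "x \<in> cbox (?h u) (?h v)" using p(1) unfolding mem_h p(2) gh .
  qed
  have img_g: "?g ` cbox u v = cbox (?g u) (?g v)" for u v
  proof -
    have "?g ` cbox u v = ?g ` ?h ` cbox (?g u) (?g v)"
      using img_h[of "?g u" "?g v"] unfolding hg by simp
    also have "\<dots> = cbox (?g u) (?g v)"
      by (simp add: image_image)
    finally show ?thesis .
  qed
  have "((\<lambda>x. f (?g x)) has_integral (1 / 1) *\<^sub>R i) (?h ` cbox (a,c) (b,d))"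
  proof (rule has_integral_twiddle[OF _ hg gh _ _ _ _ assms])
    fix u v :: "real^2"
    show "measure lborel (?g ` cbox u v) = 1 * measure lborel (cbox u v)"
    proof (cases "u$1 \<le> v$1 \<and> u$2 \<le> v$2")
      case True
      then have "measure lborel (cbox u v) = (v$1 - u$1) * (v$2 - u$2)"
        by (simp add: content_cbox_cart interval_ne_empty_cart forall_2 UNIV_2)
      then show ?thesis unfolding img_g using True by (simp add: content_Pair)
    next
      case False
      then have "cbox u v = {}" using interval_ne_empty_cart(1)[of u v] unfolding forall_2 by blast
      then show ?thesis by simp
    qed
  qed (use img_g img_h in \<open>auto intro!: continuous_intros exI\<close>)
  then show ?thesis unfolding img_h by simp
qed

text \<open>
  The real-linear map \<open>L w = w - \<kappa> * cnj w\<close> has determinant \<open>1 - \<bar>\<kappa>\<bar>\<^sup>2\<close>.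
  It is composed with \<open>H\<close> because it turns ellipses into discs.
\<close>
lemma area_rectangle_bound:
  fixes H H' :: "complex \<Rightarrow> complex" and \<kappa> :: complex
  assumes ab: "a \<le> b" "c \<le> d"
    and der: "\<And>s t. a \<le> s \<Longrightarrow> s \<le> b \<Longrightarrow> c \<le> t \<Longrightarrow> t \<le> d \<Longrightarrow>
                (H has_field_derivative H' (Complex s t)) (at (Complex s t))"
    and cont: "continuous_on {z. a \<le> Re z \<and> Re z \<le> b \<and> c \<le> Im z \<and> Im z \<le> d} H'"
    and inj: "inj_on H {z. a < Re z \<and> Re z < b \<and> c < Im z \<and> Im z < d}"
    and \<kappa>: "norm \<kappa> < 1"
    and bound: "\<And>s t. a < s \<Longrightarrow> s < b \<Longrightarrow> c < t \<Longrightarrow> t < d \<Longrightarrow>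
                norm (H (Complex s t) - \<kappa> * cnj (H (Complex s t))) \<le> R"
    and R: "0 \<le> R"
  shows "(1 - (norm \<kappa>)\<^sup>2) * integral {a..b} (\<lambda>s. integral {c..d} (\<lambda>t. (norm (H' (Complex s t)))\<^sup>2)) \<le> pi * R\<^sup>2"
proof -
  define P where "P = (\<lambda>x::real^2. Complex (x$1) (x$2))"
  define Q where "Q = (\<lambda>z. vector [Re z, Im z] :: real^2)"
  define L where "L = (\<lambda>w. w - \<kappa> * cnj w)"
  define G where "G = (\<lambda>x. Q (L (H (P x))))"
  define G' where "G' = (\<lambda>x v. Q (L (H' (P x) * P v)))"
  define S where "S = box (vector [a,c]) (vector [b,d] :: real^2)"
  have P_alt: "P = (\<lambda>x. of_real (x$1) + \<i> * of_real (x$2))"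
    by (auto simp: P_def fun_eq_iff complex_eq_iff)
  have linP: "bounded_linear P"
    unfolding P_alt linear_conv_bounded_linear[symmetric]
    by (intro linearI) (auto simp: complex_eq_iff algebra_simps)
  have linQ: "bounded_linear Q"
    unfolding linear_conv_bounded_linear[symmetric]
    by (intro linearI) (auto simp: Q_def vec_eq_iff forall_2)
  have linL: "bounded_linear L"
    unfolding linear_conv_bounded_linear[symmetric]
    by (intro linearI) (auto simp: L_def algebra_simps complex_eq_iff)
  have S_iff: "x \<in> S \<longleftrightarrow> a < x$1 \<and> x$1 < b \<and> c < x$2 \<and> x$2 < d" for x
    by (auto simp: S_def mem_box_cart forall_2)
  have derG: "(G has_derivative G' x) (at x within S)" if "x \<in> S" for x
  proof -
    have "(H has_derivative (*) (H' (P x))) (at (P x))"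
      using der[of "x$1" "x$2"] that by (auto simp: S_iff P_def has_field_derivative_def)
    from has_derivative_compose[OF bounded_linear_imp_has_derivative[OF linP] this]
    have 1: "((\<lambda>x. H (P x)) has_derivative (\<lambda>v. H' (P x) * P v)) (at x)"
      by (simp)
    have "(G has_derivative G' x) (at x)"
      unfolding G_def G'_def
      by (intro bounded_linear.has_derivative[OF linQ] bounded_linear.has_derivative[OF linL] 1)
    then show ?thesis by (rule has_derivative_at_withinI)
  qed
  have injL: "inj L"
  proof (rule injI)
    fix x y assume "L x = L y"
    then have "x - y = \<kappa> * cnj (x - y)" by (simp add: L_def algebra_simps)
    then have "norm (x - y) = norm \<kappa> * norm (x - y)" by (metis complex_mod_cnj norm_mult)
    then show "x = y" using \<kappa> by auto
  qed
  have injQ: "inj Q" by (rule injI) (auto simp: Q_def complex_eq_iff vec_eq_iff forall_2)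
  have injG: "inj_on G S"
  proof (rule inj_onI)
    fix x y assume xy: "x \<in> S" "y \<in> S" "G x = G y"
    then have "H (P x) = H (P y)" 
      using injL injQ by (auto simp: G_def dest: injD)
    moreover have "P x \<in> {z. a < Re z \<and> Re z < b \<and> c < Im z \<and> Im z < d}"
                  "P y \<in> {z. a < Re z \<and> Re z < b \<and> c < Im z \<and> Im z < d}"
      using xy by (auto simp: S_iff P_def)
    ultimately have "P x = P y" by (rule inj_onD[OF inj])
    then show "x = y" by (auto simp: P_def vec_eq_iff forall_2)
  qed
  \<comment> \<open>The factor \<open>(norm (H' (P x)))\<^sup>2\<close> is the Jacobian of the
    holomorphic map \<open>H\<close>, the other factor is the determinant of
    \<open>L\<close>.\<close>
  have det: "\<bar>det (matrix (G' x))\<bar> = (1 - (norm \<kappa>)\<^sup>2) * (norm (H' (P x)))\<^sup>2" for x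
  proof -
    have "det (matrix (G' x)) = (1 - (norm \<kappa>)\<^sup>2) * (norm (H' (P x)))\<^sup>2"
      unfolding det_2 matrix_def
      by (simp add: G'_def P_def Q_def L_def axis_def cmod_power2) (simp add: power2_eq_square algebra_simps)
    moreover have "(norm \<kappa>)\<^sup>2 \<le> 1" using \<kappa> by (simp add: power_le_one)
    ultimately show ?thesis by simp
  qed
  let ?f = "\<lambda>p::real\<times>real. (1 - (norm \<kappa>)\<^sup>2) * (norm (H' (Complex (fst p) (snd p))))\<^sup>2"
  let ?I = "integral {a..b} (\<lambda>s. integral {c..d} (\<lambda>t. (norm (H' (Complex s t)))\<^sup>2))"
  have contf: "continuous_on (cbox (a,c) (b,d)) ?f"
  proof -
    have "continuous_on (cbox (a,c) (b,d)) (\<lambda>p. H' (Complex (fst p) (snd p)))"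
      by (rule continuous_on_compose2[OF cont])
         (auto simp: cbox_Pair_eq Complex_eq intro!: continuous_intros)
    then show ?thesis by (intro continuous_intros)
  qed
  have "(?f has_integral integral (cbox (a,c) (b,d)) ?f) (cbox (a,c) (b,d))"
    using integrable_continuous[OF contf] by (rule integrable_integral)
  moreover have "integral (cbox (a,c) (b,d)) ?f = (1 - (norm \<kappa>)\<^sup>2) * ?I"
    using integral_prod_continuous[OF contf] by simp
  ultimately have "(?f has_integral (1 - (norm \<kappa>)\<^sup>2) * ?I) (cbox (a,c) (b,d))"
    by (simp only:)
  from has_integral_vec2[OF this]
  have "((\<lambda>x. \<bar>det (matrix (G' x))\<bar>) has_integral (1 - (norm \<kappa>)\<^sup>2) * ?I) (cbox (vector [a,c]) (vector [b,d]))"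
    by (simp add: det P_def)
  \<comment> \<open>Injectivity is assumed on the open rectangle only, because in the application
    the sides \<open>Im z = 0\<close> and \<open>Im z = 2*pi\<close> have the same image. The
    boundary does not affect the integral.\<close>
  then have "((\<lambda>x. \<bar>det (matrix (G' x))\<bar>) has_integral (1 - (norm \<kappa>)\<^sup>2) * ?I) S"
    unfolding S_def by (simp add: has_integral_open_interval)
  then have meas: "G ` S \<in> lmeasurable" "measure lebesgue (G ` S) = (1 - (norm \<kappa>)\<^sup>2) * ?I"
    using has_measure_differentiable_image[OF _ derG injG] by (auto simp: S_def)
  have "G ` S \<subseteq> cball 0 R"
  proof
    fix y assume "y \<in> G ` S"
    then obtain x where x: "x \<in> S" "y = G x" by auto
    have "norm (Q w) = norm w" for w
      by (simp add: Q_def norm_vec_def L2_set_def UNIV_2 cmod_def)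
    then show "y \<in> cball 0 R"
      using bound[of "x$1" "x$2"] x by (auto simp: G_def S_iff P_def L_def)
  qed
  then have "measure lebesgue (G ` S) \<le> measure lebesgue (cball (0::real^2) R)"
    using meas(1) by (intro measure_mono_fmeasurable) (auto simp: fmeasurableD)
  also have "\<dots> = pi * R\<^sup>2"
    using R by (simp add: content_cball unit_ball_vol_2)
  finally show ?thesis using meas(2) by simp
qed

subsection \<open>The area theorem\<close>

text \<open>Every value outside the ellipse is already taken by \<open>1 / F\<close> inside the
  circle of radius \<open>\<rho>\<close>. An injective extension of \<open>1 / F\<close> therefore
  stays within the ellipse beyond that circle. Working with \<open>F\<close> turns the pole of
  \<open>1 / F\<close> into the regular point 0.\<close>

lemma exterior_subset_image:
  fixes F :: "complex \<Rightarrow> complex" and \<kappa> :: complex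
  assumes hol: "F holomorphic_on ball 0 r" and inj: "inj_on F (ball 0 r)" and F0: "F 0 = 0"
    and \<rho>: "0 < \<rho>" "\<rho> < r" and R: "0 \<le> R"
    and bound: "\<And>z. norm z = \<rho> \<Longrightarrow> norm (1 / F z - \<kappa> * cnj (1 / F z)) \<le> R"
    and w: "R < norm (w - \<kappa> * cnj w)"
  obtains z where "z \<noteq> 0" "norm z < \<rho>" "1 / F z = w"
proof -
  define L where "L = (\<lambda>w. w - \<kappa> * cnj w)"
  define U where "U = {v. v = 0 \<or> R < norm (L (1 / v))}"
  \<comment> \<open>\<open>U\<close> is the inversion of the exterior of an ellipse; connectedness keeps it
    inside the image, as it contains \<open>0 = F 0\<close> and avoids the boundary.\<close>
  have "starlike U"
    unfolding starlike_def
  proof (intro bexI ballI subsetI)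
    fix v x assume v: "v \<in> U" and "x \<in> closed_segment 0 v"
    then obtain t where t: "0 \<le> t" "t \<le> 1" "x = of_real t * v"
      by (auto simp: closed_segment_def scaleR_conv_of_real)
    show "x \<in> U"
    proof (cases "t = 0 \<or> v = 0")
      case False
      \<comment> \<open>\<open>L\<close> is real-linear, so moving \<open>v\<close> towards 0 by a
        factor \<open>t \<le> 1\<close> can only enlarge \<open>norm (L (1 / v))\<close>.\<close>
      have "L (1 / x) = of_real (1 / t) * L (1 / v)"
        unfolding L_def t using False by (simp add: divide_simps)
      then have "norm (L (1 / x)) = (1 / t) * norm (L (1 / v))"
        using t by (simp add: norm_mult norm_divide)
      moreover have "1 * norm (L (1 / v)) \<le> (1 / t) * norm (L (1 / v))"
        using t False by (intro mult_right_mono) auto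
      ultimately show ?thesis
        using v False by (auto simp: U_def)
    qed (auto simp: U_def t)
  qed (auto simp: U_def)
  then have conn: "connected U" by (rule starlike_imp_connected)
  have ballsub: "ball 0 \<rho> \<subseteq> ball (0::complex) r" "cball 0 \<rho> \<subseteq> ball (0::complex) r" using \<rho> by auto
  have op: "open (F ` ball 0 \<rho>)"
    using holomorphic_on_subset[OF hol ballsub(1)] inj_on_subset[OF inj ballsub(1)]
    by (intro open_mapping_thm3) auto
  have cl: "closed (F ` cball 0 \<rho>)"
    using holomorphic_on_subset[OF hol ballsub(2)]
    by (intro compact_imp_closed compact_continuous_image holomorphic_on_imp_continuous_on) auto
  have nz: "F z \<noteq> 0" if "z \<noteq> 0" "norm z < r" for z
    using inj_onD[OF inj, of z 0] that \<rho> F0 by auto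
  have disj: "U \<inter> F ` sphere 0 \<rho> = {}"
    using bound nz \<rho> by (fastforce simp: U_def L_def)
  have "U \<subseteq> F ` ball 0 \<rho>"
  proof (rule ccontr)
    assume "\<not> U \<subseteq> F ` ball 0 \<rho>"
    moreover have "0 \<in> U \<inter> F ` ball 0 \<rho>" using \<rho> F0 by (auto simp: U_def intro!: image_eqI[of _ _ 0])
    ultimately have "U \<inter> frontier (F ` ball 0 \<rho>) \<noteq> {}"
      by (intro connected_Int_frontier[OF conn]) auto
    moreover have "frontier (F ` ball 0 \<rho>) \<subseteq> F ` sphere 0 \<rho>"
    proof -
      have "closure (F ` ball 0 \<rho>) \<subseteq> F ` cball 0 \<rho>"
        by (rule closure_minimal[OF _ cl]) auto
      also have "\<dots> = F ` ball 0 \<rho> \<union> F ` sphere 0 \<rho>"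
        unfolding image_Un[symmetric] by (rule arg_cong[of _ _ "image F"]) auto
      finally show ?thesis
        using op by (auto simp: frontier_def interior_open)
    qed
    ultimately show False using disj by auto
  qed
  moreover have w0: "w \<noteq> 0" using w R by auto
  then have "1 / w \<in> U" using w by (auto simp: U_def L_def)
  ultimately obtain z where z: "z \<in> ball 0 \<rho>" "1 / w = F z" by auto
  show ?thesis
  proof
    show "1 / F z = w" "norm z < \<rho>" using z(1) w0 by (auto simp flip: z(2))
    show "z \<noteq> 0" using z w0 F0 by auto
  qed
qed

text \<open>Times \<open>pi\<close>, this is a partial sum of the signed area enclosed by the image
  of the circle of radius \<open>exp s\<close> under \<open>u z / z\<close>, where the coefficient
  with index \<open>n\<close> belongs to the power \<open>n - 1\<close>. The subtraction is real:
  the pole, \<open>n = 0\<close>, enters with weight -1.\<close>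

definition area_sum :: "complex fps \<Rightarrow> nat \<Rightarrow> real \<Rightarrow> real" where
  "area_sum U N s = (\<Sum>n\<le>N. (real n - 1) * (norm (fps_nth U n))\<^sup>2 * exp (2 * (real n - 1) * s))"

text \<open>
  Up to a factor \<open>\<pi>\<close>, the difference of two values of \<open>area_sum\<close> is what the first \<open>N\<close>
  coefficients contribute to the area of the image of an annulus under \<open>u z / z\<close>.
  The annulus is parametrised by \<open>exp\<close> on a rectangle.
\<close>
lemma area_sum_annulus_bound:
  fixes u :: "complex \<Rightarrow> complex" and \<kappa> :: complex
  assumes hol: "u holomorphic_on ball 0 1" and U: "u has_fps_expansion U"
    and inj: "inj_on (\<lambda>z. u z / z) (ball 0 1 - {0})"
    and nz: "\<And>z. norm z < r \<Longrightarrow> u z \<noteq> 0" and r: "r \<le> 1"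
    and ab: "a < b" "b < 0" and \<rho>: "exp a < r" and \<kappa>: "norm \<kappa> < 1"
    and bound: "\<And>z. norm z = exp a \<Longrightarrow> norm (u z / z - \<kappa> * cnj (u z / z)) \<le> R" and R: "0 \<le> R"
  shows "(1 - (norm \<kappa>)\<^sup>2) * (area_sum U N b - area_sum U N a) \<le> R\<^sup>2"
proof -
  \<comment> \<open>\<open>\<psi> z / z\<close> is \<open>z\<close> times the derivative of
    \<open>u z / z\<close>, which is what the substitution of \<open>exp\<close> produces in
    \<open>H'\<close>. Passing from \<open>u\<close> to \<open>\<psi>\<close> multiplies the
    coefficients by \<open>n - 1\<close>.\<close>
  define \<psi> where "\<psi> = (\<lambda>z. z * deriv u z - u z)"
  have \<psi>_hol: "\<psi> holomorphic_on ball 0 1"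
    unfolding \<psi>_def by (intro holomorphic_intros hol) auto
  have \<psi>_exp: "\<psi> has_fps_expansion fps_X * fps_deriv U - U"
    unfolding \<psi>_def by (intro fps_expansion_intros U)
  have coeff: "fps_nth (fps_X * fps_deriv U - U) n = of_real (real n - 1) * fps_nth U n" for n
    by (cases n) (auto simp: algebra_simps)
  define H where "H = (\<lambda>w. u (exp w) / exp w)"
  define H' where "H' = (\<lambda>w. \<psi> (exp w) / exp w)"
  have expin: "exp w \<in> ball 0 1" if "Re w \<le> b" for w :: complex
    using that ab by (simp add: norm_exp_eq_Re)
  have der: "(H has_field_derivative H' w) (at w)" if "Re w \<le> b" for w
  proof -
    have "(u has_field_derivative deriv u (exp w)) (at (exp w))"
      using holomorphic_derivI[OF hol open_ball expin[OF that]] .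
    from DERIV_chain2[OF this DERIV_exp]
    have "((\<lambda>w. u (exp w)) has_field_derivative deriv u (exp w) * exp w) (at w)" .
    then show ?thesis
      unfolding H_def H'_def \<psi>_def
      by (auto intro!: derivative_eq_intros simp: field_simps power2_eq_square)
  qed
  have cont: "continuous_on {z. a \<le> Re z \<and> Re z \<le> b \<and> 0 \<le> Im z \<and> Im z \<le> 2*pi} H'"
    unfolding H'_def
    by (intro continuous_intros continuous_on_compose2[OF holomorphic_on_imp_continuous_on[OF \<psi>_hol]])
       (use expin in auto)
  have injH: "inj_on H {z. a < Re z \<and> Re z < b \<and> 0 < Im z \<and> Im z < 2*pi}"
  proof (rule inj_onI, clarsimp)
    fix x y assume xy: "a < Re x" "a < Re y" "Re x < b" "Re y < b" "0 < Im x" "0 < Im y" 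
      "Im x < 2*pi" "Im y < 2*pi" "H x = H y"
    have "exp x = exp y"
      using inj_onD[OF inj, of "exp x" "exp y"] xy expin[of x] expin[of y] by (auto simp: H_def)
    then show "x = y" using xy by (intro exp_complex_eqI[OF _ \<open>exp x = exp y\<close>]) auto
  qed
  \<comment> \<open>A value \<open>H w\<close> outside the ellipse would also be taken at some
    \<open>z\<close> with \<open>norm z < exp a < norm (exp w)\<close>, against injectivity.\<close>
  have boundH: "norm (H w - \<kappa> * cnj (H w)) \<le> R" if "a < Re w" "Re w < b" for w
  proof (rule ccontr)
    assume "\<not> norm (H w - \<kappa> * cnj (H w)) \<le> R"
    then have gt: "R < norm (H w - \<kappa> * cnj (H w))" by simp
    define F where "F = (\<lambda>z. z / u z)"
    have "F holomorphic_on ball 0 r"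
      unfolding F_def using r nz by (intro holomorphic_intros holomorphic_on_subset[OF hol]) auto
    moreover have "inj_on F (ball 0 r)"
    proof (rule inj_onI)
      fix x y assume xy: "x \<in> ball 0 r" "y \<in> ball 0 r" "F x = F y"
      have nz': "u x \<noteq> 0" "u y \<noteq> 0" using nz xy by auto
      show "x = y"
      proof (cases "x = 0 \<or> y = 0")
        case True
        then show ?thesis using xy nz' by (auto simp: F_def)
      next
        case False
        then have "u x / x = u y / y" using xy nz' by (auto simp: F_def field_simps)
        then show ?thesis using inj_onD[OF inj, of x y] xy r False by auto
      qed
    qed
    ultimately obtain z where z: "z \<noteq> 0" "norm z < exp a" "1 / F z = H w"
      using exterior_subset_image[of F r "exp a" R \<kappa> "H w"] \<rho> R bound gt
      by (auto simp: F_def)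
    have "z = exp w"
      using inj_onD[OF inj, of z "exp w"] z expin[of w] that \<rho> r by (auto simp: F_def H_def)
    then show False using z(2) that by (simp add: norm_exp_eq_Re)
  qed
  let ?inner = "\<lambda>s. integral {0..2*pi} (\<lambda>t. (norm (H' (Complex s t)))\<^sup>2)"
  have area: "(1 - (norm \<kappa>)\<^sup>2) * integral {a..b} ?inner \<le> pi * R\<^sup>2"
    using ab by (intro area_rectangle_bound[OF _ _ _ cont injH \<kappa> _ R] der boundH) auto
  \<comment> \<open>\<open>T'\<close> is the derivative of \<open>area_sum U N\<close>, so Bessel's
    inequality on each circle integrates to the difference of the two end values.\<close>
  define T' where "T' = (\<lambda>s. \<Sum>n\<le>N. (real n - 1) * (norm (fps_nth U n))\<^sup>2 * (exp (2 * (real n - 1) * s) * (2 * (real n - 1))))"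
  have "(T' has_integral area_sum U N b - area_sum U N a) {a..b}"
    unfolding T'_def area_sum_def using ab
    by (intro fundamental_theorem_of_calculus)
       (auto intro!: derivative_eq_intros simp: mult_ac simp flip: has_real_derivative_iff_has_vector_derivative)
  then have T': "((\<lambda>s. pi * T' s) has_integral pi * (area_sum U N b - area_sum U N a)) {a..b}"
    by (rule has_integral_mult_right)
  have inner_ge: "pi * T' s \<le> ?inner s" if "s \<in> {a..b}" for s
  proof -
    have "exp (Complex s t) = of_real (exp s) * cis t" for t
      by (simp add: exp_eq_polar)
    then have *: "(norm (H' (Complex s t)))\<^sup>2 = exp (- (2 * s)) * (norm (\<psi> (of_real (exp s) * cis t)))\<^sup>2" for t
      by (simp add: H'_def norm_divide norm_mult power_divide exp_minus divide_simps flip: exp_double)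
    have "2 * pi * (\<Sum>n<Suc N. (norm (fps_nth (fps_X * fps_deriv U - U) n))\<^sup>2 * exp s ^ (2*n))
      \<le> integral {0..2*pi} (\<lambda>t. (norm (\<psi> (of_real (exp s) * cis t)))\<^sup>2)"
      using that ab by (intro bessel_circle[OF \<psi>_hol \<psi>_exp]) auto
    then have "exp (- (2 * s)) * (2 * pi * (\<Sum>n<Suc N. (norm (fps_nth (fps_X * fps_deriv U - U) n))\<^sup>2 * exp s ^ (2*n))) \<le> ?inner s"
      unfolding * integral_mult_right by (rule mult_left_mono) simp
    moreover have "exp (- (2 * s)) * (2 * pi * (\<Sum>n<Suc N. (norm (fps_nth (fps_X * fps_deriv U - U) n))\<^sup>2 * exp s ^ (2*n))) = pi * T' s"
      unfolding T'_def sum_distrib_left coeff lessThan_Suc_atMost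
    proof (intro sum.cong refl)
      fix n
      have "exp (2 * (real n - 1) * s) = exp (- (2 * s)) * exp s ^ (2*n)"
        by (simp add: exp_add[symmetric] algebra_simps flip: exp_of_nat_mult)
      moreover have "(norm (of_real (real n - 1) * fps_nth U n))\<^sup>2 = (real n - 1)\<^sup>2 * (norm (fps_nth U n))\<^sup>2"
        by (simp only: norm_mult norm_of_real power_mult_distrib power2_abs)
      ultimately show "exp (- (2 * s)) * (2 * pi * ((norm (of_real (real n - 1) * fps_nth U n))\<^sup>2 * exp s ^ (2*n)))
        = pi * ((real n - 1) * (norm (fps_nth U n))\<^sup>2 * (exp (2 * (real n - 1) * s) * (2 * (real n - 1))))"
        by (simp only:) (simp add: power2_eq_square mult_ac)
    qed
    ultimately show ?thesis by (simp only:)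
  qed
  have "?inner integrable_on {a..b}"
  proof -
    have "continuous_on (cbox (a, 0) (b, 2*pi)) (\<lambda>p. (norm (H' (Complex (fst p) (snd p))))\<^sup>2)"
      by (intro continuous_intros continuous_on_compose2[OF cont])
         (auto simp: cbox_Pair_eq Complex_eq intro!: continuous_intros)
    from integral_integrable_2dim[OF this] show ?thesis by simp
  qed
  then have "pi * (area_sum U N b - area_sum U N a) \<le> integral {a..b} ?inner"
    using has_integral_le[OF T' integrable_integral] inner_ge by blast
  moreover have "0 \<le> 1 - (norm \<kappa>)\<^sup>2" using \<kappa> by (simp add: power_le_one)
  ultimately have "(1 - (norm \<kappa>)\<^sup>2) * (pi * (area_sum U N b - area_sum U N a)) \<le> pi * R\<^sup>2"
    using area by (meson mult_left_mono order_trans)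
  then have "pi * ((1 - (norm \<kappa>)\<^sup>2) * (area_sum U N b - area_sum U N a)) \<le> pi * R\<^sup>2"
    by (simp only: mult.left_commute)
  then show ?thesis by (rule mult_left_le_imp_le) simp
qed

text \<open>The inner radius \<open>\<rho>\<close> tends to 0 first: the area
  \<open>1 / \<rho>\<^sup>2\<close> contributed by the pole cancels against that of the enclosing
  disc. Then \<open>b\<close> tends to 0. Without a constant term in \<open>u z / z\<close> the
  enclosing ellipse can be centred at 0.\<close>

lemma area_theorem_centered:
  fixes u :: "complex \<Rightarrow> complex"
  assumes hol: "u holomorphic_on ball 0 1" and U: "u has_fps_expansion U"
    and inj: "inj_on (\<lambda>z. u z / z) (ball 0 1 - {0})"
    and U0: "fps_nth U 0 = 1" and U1: "fps_nth U 1 = 0"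
  shows "(\<Sum>n\<le>N. (real n - 1) * (norm (fps_nth U n))\<^sup>2) \<le> 0"
proof -
  define \<beta> where "\<beta> = fps_nth U 2"
  define B where "B = norm \<beta>"
  \<comment> \<open>Remainder in \<open>u z / z = 1 / z + \<beta> * z + z\<^sup>2 * m z\<close>;
    only its boundedness near 0 matters.\<close>
  define m where "m = (\<lambda>z. if z = 0 then fps_nth U 3 else (u z - (1 + \<beta> * z^2)) / z ^ 3)"
  have m_exp: "m has_fps_expansion fps_shift 3 (U - (1 + fps_const \<beta> * fps_X ^ 2))"
  proof -
    have "(\<lambda>z. u z - (1 + \<beta> * z^2)) has_fps_expansion U - (1 + fps_const \<beta> * fps_X ^ 2)"
      by (intro fps_expansion_intros U)
    moreover have "fps_nth (U - (1 + fps_const \<beta> * fps_X ^ 2)) i = 0" if "i < 3" for i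
    proof -
      from that have "i = 0 \<or> i = 1 \<or> i = 2" by auto
      then show ?thesis using U0 U1 by (auto simp: \<beta>_def)
    qed
    ultimately have "(\<lambda>z. if z = 0 then fps_nth (U - (1 + fps_const \<beta> * fps_X ^ 2)) 3
        else (u z - (1 + \<beta> * z^2)) / z ^ 3) has_fps_expansion fps_shift 3 (U - (1 + fps_const \<beta> * fps_X ^ 2))"
      by (rule has_fps_expansion_divide_power)
    moreover have "fps_nth (U - (1 + fps_const \<beta> * fps_X ^ 2)) 3 = fps_nth U 3"
      by simp
    ultimately show ?thesis
      unfolding m_def by (simp only:)
  qed
  have "(m \<longlongrightarrow> m 0) (nhds 0)"
    using has_fps_expansion_imp_tendsto_0[OF m_exp] has_fps_expansion_imp_0_eq_fps_nth_0[OF m_exp] by metis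
  then have "eventually (\<lambda>z. dist (m z) (m 0) < 1) (nhds 0)"
    by (rule tendstoD) simp
  moreover have "eventually (\<lambda>z. u z \<noteq> 0) (nhds 0)"
  proof -
    have "(u \<longlongrightarrow> 1) (nhds 0)"
      using has_fps_expansion_imp_tendsto_0[OF U] U0 by simp
    then show ?thesis by (rule tendsto_imp_eventually_ne) simp
  qed
  ultimately have "eventually (\<lambda>z. dist (m z) (m 0) < 1 \<and> u z \<noteq> 0) (nhds 0)"
    by (rule eventually_conj)
  then obtain r' where r': "0 < r'" "\<And>z. norm z < r' \<Longrightarrow> dist (m z) (m 0) < 1 \<and> u z \<noteq> 0"
    unfolding eventually_nhds_metric by auto
  define r where "r = min r' 1"
  define K where "K = norm (m 0) + 1"
  \<comment> \<open>\<open>C\<close> collects the three error terms left once \<open>L\<close> has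
    cancelled \<open>\<beta> * z\<close>, so that the radius is
    \<open>1 / \<rho> + C * \<rho>\<^sup>2\<close>. \<open>D\<close> bounds the inner area apart
    from the pole: its term \<open>n = 1\<close> is zero, and for \<open>n \<ge> 2\<close> the power
    of \<open>\<rho>\<close> is at least 2.\<close>
  define C where "C = K + B^2 + B * K"
  define D where "D = (\<Sum>n=1..N. (real n - 1) * (norm (fps_nth U n))\<^sup>2)"
  have K: "0 \<le> K" "0 \<le> B" "0 \<le> C" by (auto simp: K_def B_def C_def)
  have r: "0 < r" "r \<le> 1" using r' by (auto simp: r_def)
  have nz: "u z \<noteq> 0" if "norm z < r" for z using that r' by (auto simp: r_def)
  have mK: "norm (m z) \<le> K" if "norm z < r" for z
  proof -
    have "norm (m z - m 0) < 1" using r'(2)[of z] that by (simp add: r_def dist_norm)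
    then show ?thesis unfolding K_def using norm_triangle_sub[of "m z" "m 0"] by linarith
  qed
  \<comment> \<open>With \<open>\<kappa> = \<beta> * \<rho>\<^sup>2\<close> the map \<open>L\<close> cancels the term \<open>\<beta> * z\<close> on \<open>\<bar>z\<bar> = \<rho>\<close>, so the image of this
    circle lies in a disc of area \<open>\<pi> / \<rho>\<^sup>2 + o(1)\<close>; a disc around the image without \<open>L\<close>
    would leave an error of order one.\<close>
  have ineq: "(1 - B\<^sup>2 * \<rho> ^ 4) * (area_sum U N b - D * \<rho>\<^sup>2) \<le> B\<^sup>2 * \<rho>\<^sup>2 + 2 * C * \<rho> + C\<^sup>2 * \<rho> ^ 4"
    if b: "b < 0" and \<rho>: "0 < \<rho>" "\<rho> < r" "\<rho> < exp b" "B * \<rho>\<^sup>2 < 1" for b \<rho>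
  proof -
    define \<kappa> where "\<kappa> = \<beta> * of_real (\<rho>\<^sup>2)"
    have \<rho>1: "\<rho> \<le> 1" using \<rho> r by linarith
    have n\<kappa>: "norm \<kappa> = B * \<rho>\<^sup>2" using \<rho> by (simp add: \<kappa>_def B_def norm_mult norm_power)
    have bound: "norm (u z / z - \<kappa> * cnj (u z / z)) \<le> 1 / \<rho> + C * \<rho>\<^sup>2" if z: "norm z = \<rho>" for z
    proof -
      have z0: "z \<noteq> 0" using z \<rho> by auto
      have zz: "z * cnj z = of_real (\<rho>\<^sup>2)" using z by (simp add: flip: complex_norm_square)
      have uz: "u z / z = 1 / z + \<beta> * z + z\<^sup>2 * m z"
        using z0 by (simp add: m_def field_simps power2_eq_square power3_eq_cube)
      have cancel: "\<kappa> * cnj (1 / z) = \<beta> * z"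
        unfolding \<kappa>_def zz[symmetric] using z0 by simp
      have "u z / z - \<kappa> * cnj (u z / z)
          = 1 / z + (\<beta> * z - \<kappa> * cnj (1 / z)) + z\<^sup>2 * m z - \<kappa> * cnj (\<beta> * z) - \<kappa> * cnj (z\<^sup>2 * m z)"
        unfolding uz by (simp only: complex_cnj_add) (simp add: algebra_simps)
      also have "\<dots> = 1 / z + z\<^sup>2 * m z - \<kappa> * cnj (\<beta> * z) - \<kappa> * cnj (z\<^sup>2 * m z)"
        unfolding cancel by simp
      also have "norm \<dots> \<le> norm (1 / z) + norm (z\<^sup>2 * m z) + norm (\<kappa> * cnj (\<beta> * z)) + norm (\<kappa> * cnj (z\<^sup>2 * m z))"
        by (intro order_trans[OF norm_triangle_ineq4] add_mono order_trans[OF norm_triangle_ineq] order_refl)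
      also have "\<dots> = 1 / \<rho> + \<rho>\<^sup>2 * norm (m z) + (B * \<rho>\<^sup>2) * (B * \<rho>) + (B * \<rho>\<^sup>2) * (\<rho>\<^sup>2 * norm (m z))"
        by (simp only: norm_mult n\<kappa> complex_mod_cnj norm_power norm_divide norm_one z B_def[symmetric])
      also have "\<dots> \<le> 1 / \<rho> + \<rho>\<^sup>2 * K + (B * \<rho>\<^sup>2) * (B * 1) + (B * \<rho>\<^sup>2) * (1 * K)"
        using mK[of z] z \<rho> \<rho>1 K by (intro add_mono mult_mono order_refl) (auto simp: power_le_one)
      also have "\<dots> = 1 / \<rho> + C * \<rho>\<^sup>2"
        by (simp add: C_def algebra_simps power2_eq_square)
      finally show ?thesis .
    qed
    have main: "(1 - (norm \<kappa>)\<^sup>2) * (area_sum U N b - area_sum U N (ln \<rho>)) \<le> (1 / \<rho> + C * \<rho>\<^sup>2)\<^sup>2"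
    proof (rule area_sum_annulus_bound[OF hol U inj nz r(2)])
      show "ln \<rho> < b" using \<rho> by (metis exp_ln exp_less_cancel_iff)
    qed (use b \<rho> n\<kappa> bound K in auto)
    have "area_sum U N (ln \<rho>) \<le> - 1 / \<rho>\<^sup>2 + D * \<rho>\<^sup>2"
    proof -
      have "{..N} = insert 0 {1..N}" by auto
      then have "area_sum U N (ln \<rho>) = - exp (- 2 * ln \<rho>) + (\<Sum>n=1..N. (real n - 1) * (norm (fps_nth U n))\<^sup>2 * exp (2 * (real n - 1) * ln \<rho>))"
        by (simp add: area_sum_def U0)
      moreover have "exp (- 2 * ln \<rho>) = 1 / \<rho>\<^sup>2"
        using \<rho> by (simp add: exp_minus exp_double divide_inverse)
      moreover have "(\<Sum>n=1..N. (real n - 1) * (norm (fps_nth U n))\<^sup>2 * exp (2 * (real n - 1) * ln \<rho>)) \<le> D * \<rho>\<^sup>2"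
        unfolding D_def sum_distrib_right
      proof (rule sum_mono)
        fix n assume n: "n \<in> {1..N}"
        show "(real n - 1) * (norm (fps_nth U n))\<^sup>2 * exp (2 * (real n - 1) * ln \<rho>)
          \<le> (real n - 1) * (norm (fps_nth U n))\<^sup>2 * \<rho>\<^sup>2"
        proof (cases "n = 1")
          case False
          then have "2 * (real n - 1) * ln \<rho> \<le> 2 * 1 * ln \<rho>"
            using n \<rho> \<rho>1 by (intro mult_right_mono_neg) auto
          then have "exp (2 * (real n - 1) * ln \<rho>) \<le> exp (2 * 1 * ln \<rho>)" by (simp only: exp_le_cancel_iff)
          also have "\<dots> = \<rho>\<^sup>2" using \<rho> by (simp add: exp_double)
          finally show ?thesis using n by (intro mult_left_mono) auto
        qed simp
      qed
      ultimately show ?thesis by simp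
    qed
    then have "area_sum U N b - D * \<rho>\<^sup>2 + 1 / \<rho>\<^sup>2 \<le> area_sum U N b - area_sum U N (ln \<rho>)"
      by simp
    moreover have "0 \<le> 1 - (norm \<kappa>)\<^sup>2" using \<rho> n\<kappa> K by (simp add: power_le_one)
    ultimately have "(1 - (norm \<kappa>)\<^sup>2) * (area_sum U N b - D * \<rho>\<^sup>2 + 1 / \<rho>\<^sup>2) \<le> (1 / \<rho> + C * \<rho>\<^sup>2)\<^sup>2"
      using main by (meson mult_left_mono order_trans)
    moreover have "(norm \<kappa>)\<^sup>2 = B\<^sup>2 * \<rho> ^ 4"
      by (simp add: n\<kappa> power_mult_distrib flip: power_mult)
    \<comment> \<open>Both sides are expanded to expose the common term
      \<open>1 / \<rho>\<^sup>2\<close>; what remains on the right tends to 0 with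
      \<open>\<rho>\<close>.\<close>
    moreover have "(1 - B\<^sup>2 * \<rho> ^ 4) * (area_sum U N b - D * \<rho>\<^sup>2 + 1 / \<rho>\<^sup>2)
      = (1 - B\<^sup>2 * \<rho> ^ 4) * (area_sum U N b - D * \<rho>\<^sup>2) + 1 / \<rho>\<^sup>2 - B\<^sup>2 * \<rho>\<^sup>2"
      using \<rho> by (simp add: field_simps)
    moreover have "(1 / \<rho> + C * \<rho>\<^sup>2)\<^sup>2 = 1 / \<rho>\<^sup>2 + 2 * C * \<rho> + C\<^sup>2 * \<rho> ^ 4"
      using \<rho> by (simp add: field_simps power2_eq_square power4_eq_xxxx)
    ultimately show ?thesis by simp
  qed
  have neg: "area_sum U N b \<le> 0" if b: "b < 0" for b
  proof -
    let ?l = "\<lambda>\<rho>. (1 - B\<^sup>2 * \<rho> ^ 4) * (area_sum U N b - D * \<rho>\<^sup>2)"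
    let ?r = "\<lambda>\<rho>. B\<^sup>2 * \<rho>\<^sup>2 + 2 * C * \<rho> + C\<^sup>2 * \<rho> ^ 4"
    have "(?l \<longlongrightarrow> (1 - B\<^sup>2 * 0 ^ 4) * (area_sum U N b - D * 0\<^sup>2)) (at_right 0)"
      by (intro tendsto_intros)
    moreover have "(?r \<longlongrightarrow> B\<^sup>2 * 0\<^sup>2 + 2 * C * 0 + C\<^sup>2 * 0 ^ 4) (at_right 0)"
      by (intro tendsto_intros)
    moreover have "eventually (\<lambda>\<rho>. ?l \<rho> \<le> ?r \<rho>) (at_right 0)"
    proof -
      have "((\<lambda>\<rho>. B * \<rho>\<^sup>2) \<longlongrightarrow> B * 0\<^sup>2) (at_right 0)" by (intro tendsto_intros)
      then have "eventually (\<lambda>\<rho>. B * \<rho>\<^sup>2 < 1) (at_right 0)" by (rule order_tendstoD) simp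
      moreover have "eventually (\<lambda>\<rho>::real. \<rho> \<in> {0<..<min r (exp b)}) (at_right 0)"
        using r by (intro eventually_at_right_real) simp
      ultimately show ?thesis
        by eventually_elim (rule ineq[OF b], auto)
    qed
    ultimately show ?thesis
      using tendsto_le[OF trivial_limit_at_right_real, of ?r _ 0 ?l] by fastforce
  qed
  have "(area_sum U N \<longlongrightarrow> area_sum U N 0) (at_left 0)"
    unfolding area_sum_def by (intro tendsto_intros)
  then have "area_sum U N 0 \<le> 0"
    by (rule tendsto_upperbound)
       (use neg in \<open>auto simp: eventually_at_left_field intro: exI[of _ "-1"]\<close>)
  then show ?thesis by (simp add: area_sum_def)
qed

text \<open>Subtracting the constant \<open>c\<close> from \<open>u z / z\<close> keeps it injective
  and alters only the coefficient with index 1, whose weight is 0.\<close>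

theorem area_theorem:
  fixes u :: "complex \<Rightarrow> complex"
  assumes hol: "u holomorphic_on ball 0 1" and U: "u has_fps_expansion U"
    and inj: "inj_on (\<lambda>z. u z / z) (ball 0 1 - {0})" and U0: "fps_nth U 0 = 1"
  shows "(\<Sum>n\<le>N. (real n - 1) * (norm (fps_nth U n))\<^sup>2) \<le> 0"
proof -
  define c where "c = fps_nth U 1"
  have "(\<lambda>z. u z - c * z) has_fps_expansion U - fps_const c * fps_X"
    by (intro fps_expansion_intros U)
  moreover have "inj_on (\<lambda>z. (u z - c * z) / z) (ball 0 1 - {0})"
    using inj by (auto simp: inj_on_def diff_divide_distrib)
  ultimately have "(\<Sum>n\<le>N. (real n - 1) * (norm (fps_nth (U - fps_const c * fps_X) n))\<^sup>2) \<le> 0"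
    by (intro area_theorem_centered) (auto intro!: holomorphic_intros hol simp: c_def U0)
  moreover have "(real n - 1) * (norm (fps_nth (U - fps_const c * fps_X) n))\<^sup>2 = (real n - 1) * (norm (fps_nth U n))\<^sup>2" for n
    by (cases "n = 1") (auto simp: fps_X_def)
  ultimately show ?thesis by (simp only:)
qed

subsection \<open>Logarithmic coefficients\<close>

text \<open>\<open>f z / z\<close> extends to a zero-free function on the simply connected disc, so
  its reciprocal has a holomorphic square root.\<close>

lemma classS_inverse_sqrt:
  assumes "classS f"
  obtains e where "e holomorphic_on ball 0 1" "e 0 = 1" "\<And>z. z \<in> ball 0 1 \<Longrightarrow> (e z)\<^sup>2 * f z = z"
proof -
  have f: "f holomorphic_on ball 0 1" "inj_on f (ball 0 1)" "f 0 = 0" "deriv f 0 = 1"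
    using assms by (auto simp: classS_def)
  define q where "q = (\<lambda>z. if z = 0 then deriv f 0 else (f z - f 0) / (z - 0))"
  have q_hol: "q holomorphic_on ball 0 1"
    unfolding q_def using pole_lemma[OF f(1), of 0] by simp
  have q_nz: "q z \<noteq> 0" if "z \<in> ball 0 1" for z
    using inj_onD[OF f(2), of z 0] that f by (auto simp: q_def)
  have "simply_connected (ball (0::complex) 1)"
    by (intro convex_imp_simply_connected convex_ball)
  moreover have "(\<lambda>z. 1 / q z) holomorphic_on ball 0 1"
    using q_hol q_nz by (intro holomorphic_intros) auto
  ultimately obtain g where g: "g holomorphic_on ball 0 1" "\<And>z. z \<in> ball 0 1 \<Longrightarrow> 1 / q z = (g z)\<^sup>2"
    using q_nz by (auto simp: simply_connected_eq_holomorphic_sqrt)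
  have g0: "(g 0)\<^sup>2 = 1" using g(2)[of 0] f by (simp add: q_def)
  show ?thesis
  proof
    \<comment> \<open>\<open>g 0\<close> is 1 or -1, so this factor fixes the sign of the root at 0
      and leaves its square unchanged.\<close>
    show "(\<lambda>z. g z * g 0) holomorphic_on ball 0 1" by (intro holomorphic_intros g)
    show "g 0 * g 0 = 1" using g0 by (simp add: power2_eq_square)
    show "(g z * g 0)\<^sup>2 * f z = z" if "z \<in> ball 0 1" for z
    proof -
      have "(g z * g 0)\<^sup>2 * f z = 1 / q z * f z"
        by (simp only: g(2)[OF that] power_mult_distrib g0 mult_1_right)
      also have "\<dots> = z" using q_nz[OF that] f by (auto simp: q_def field_simps split: if_splits)
      finally show ?thesis .
    qed
  qed
qed

text \<open>Comparing coefficients in \<open>E\<^sup>2 * F = fps_X\<close> expresses the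
  coefficients of \<open>f\<close> through those of \<open>E\<close>. The multiple of
  \<open>gamma3 f\<close> is chosen so that \<open>fps_nth E 3\<close> drops out; the mixed term in
  \<open>fps_nth E 1\<close> and \<open>fps_nth E 2\<close> cancels with it.\<close>

lemma gamma_via_inverse_sqrt:
  fixes E F :: "complex fps"
  assumes EF: "E\<^sup>2 * F = fps_X" and E0: "fps_nth E 0 = 1" and F0: "fps_nth F 0 = 0"
    and F: "\<And>n. fps_nth F n = tcoeff f n"
  shows "gamma4 f + fps_nth E 1 * gamma3 f = - fps_nth E 4 + (fps_nth E 2)\<^sup>2 / 2 - fps_nth E 1 ^ 4 / 12"
proof -
  define e1 e2 e3 e4 where e: "e1 = fps_nth E 1" "e2 = fps_nth E 2" "e3 = fps_nth E 3" "e4 = fps_nth E 4"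
  have Q: "fps_nth (E\<^sup>2) n = (\<Sum>i=0..n. fps_nth E i * fps_nth E (n - i))" for n
    by (simp add: power2_eq_square fps_mult_nth)
  have Q_vals: "fps_nth (E\<^sup>2) 0 = 1" "fps_nth (E\<^sup>2) 1 = 2 * e1" "fps_nth (E\<^sup>2) 2 = 2 * e2 + e1\<^sup>2"
     "fps_nth (E\<^sup>2) 3 = 2 * e3 + 2 * e1 * e2" "fps_nth (E\<^sup>2) 4 = 2 * e4 + 2 * e1 * e3 + e2\<^sup>2"
    unfolding Q e by (simp_all add: E0 numeral_eq_Suc)
  have P: "(\<Sum>i=0..n. fps_nth (E\<^sup>2) i * fps_nth F (n - i)) = fps_nth fps_X n" for n
    unfolding EF[symmetric] by (simp add: fps_mult_nth)
  have F1: "fps_nth F 1 = 1"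
    using P[of 1] F0 Q_vals by simp
  have "tcoeff f 2 + 2 * e1 = 0"
    using P[of 2] F0 F1 Q_vals by (simp add: numeral_eq_Suc F)
  then have a2: "tcoeff f 2 = - 2 * e1" by algebra
  have "tcoeff f 3 + 2 * e1 * tcoeff f 2 + (2 * e2 + e1\<^sup>2) = 0"
    using P[of 3] F0 F1 Q_vals by (simp add: numeral_eq_Suc F)
  then have a3: "tcoeff f 3 = 3 * e1\<^sup>2 - 2 * e2" unfolding a2 by algebra
  have "tcoeff f 4 + 2 * e1 * tcoeff f 3 + (2 * e2 + e1\<^sup>2) * tcoeff f 2 + (2 * e3 + 2 * e1 * e2) = 0"
    using P[of 4] F0 F1 Q_vals by (simp add: numeral_eq_Suc F)
  then have a4: "tcoeff f 4 = - 4 * e1 ^ 3 + 6 * e1 * e2 - 2 * e3" unfolding a2 a3 by algebra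
  have "tcoeff f 5 + 2 * e1 * tcoeff f 4 + (2 * e2 + e1\<^sup>2) * tcoeff f 3
       + (2 * e3 + 2 * e1 * e2) * tcoeff f 2 + (2 * e4 + 2 * e1 * e3 + e2\<^sup>2) = 0"
    using P[of 5] F0 F1 Q_vals by (simp add: numeral_eq_Suc F)
  then have a5: "tcoeff f 5 = 5 * e1 ^ 4 - 12 * e1\<^sup>2 * e2 + 6 * e1 * e3 + 3 * e2\<^sup>2 - 2 * e4"
    unfolding a2 a3 a4 by algebra
  show ?thesis
    unfolding gamma3_def gamma4_def Let_def e[symmetric] a5 a4 a3 a2
    by (simp add: field_simps power2_eq_square power3_eq_cube power4_eq_xxxx)
qed

theorem theorem1:
  fixes f :: "complex \<Rightarrow> complex"
  assumes "classS f"
  shows "norm (gamma4 f) - norm (gamma3 f) \<le> 1 / sqrt 7"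
proof -
  have f: "f holomorphic_on ball 0 1" "inj_on f (ball 0 1)" "f 0 = 0"
    using assms by (auto simp: classS_def)
  obtain e where e: "e holomorphic_on ball 0 1" "e 0 = 1" "\<And>z. z \<in> ball 0 1 \<Longrightarrow> (e z)\<^sup>2 * f z = z"
    using classS_inverse_sqrt[OF assms] by blast
  define E where "E = fps_expansion e 0"
  define F where "F = fps_expansion f 0"
  have E: "e has_fps_expansion E" and F: "f has_fps_expansion F"
    unfolding E_def F_def using e(1) f(1) by (auto intro: has_fps_expansion_fps_expansion[of "ball 0 1"])
  have "(\<lambda>z. (e z)\<^sup>2 * f z) has_fps_expansion E\<^sup>2 * F"
    by (intro fps_expansion_intros E F)
  moreover have "eventually (\<lambda>z. (e z)\<^sup>2 * f z = z) (nhds 0)"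
    by (rule eventually_nhds_in_open[of "ball 0 1", THEN eventually_mono]) (auto simp: e(3))
  ultimately have "(\<lambda>z. z) has_fps_expansion E\<^sup>2 * F"
    by (subst (asm) has_fps_expansion_cong) auto
  then have EF: "E\<^sup>2 * F = fps_X"
    by (rule fps_expansion_unique_complex[OF _ has_fps_expansion_fps_X])
  have E0: "fps_nth E 0 = 1" and F0: "fps_nth F 0 = 0"
    using has_fps_expansion_imp_0_eq_fps_nth_0[OF E] has_fps_expansion_imp_0_eq_fps_nth_0[OF F] e(2) f(3)
    by auto
  have sq: "z\<^sup>2 \<in> ball 0 1" if "z \<in> ball 0 1" for z :: complex
    using that by (simp add: norm_power power_less_one_iff)
  \<comment> \<open>Substituting the square moves the coefficient \<open>n\<close> of
    \<open>E\<close> to index \<open>2 * n\<close>, where the area theorem gives it weight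
    \<open>2 * n - 1\<close>.\<close>
  define U where "U = E oo fps_X\<^sup>2"
  have "(e \<circ> (\<lambda>z. z\<^sup>2)) has_fps_expansion U"
    unfolding U_def by (intro has_fps_expansion_compose E has_fps_expansion_fps_X_power) simp
  then have U: "(\<lambda>z. e (z\<^sup>2)) has_fps_expansion U" by (simp add: o_def)
  have u_hol: "(\<lambda>z. e (z\<^sup>2)) holomorphic_on ball 0 1"
  proof -
    have "(\<lambda>z. z\<^sup>2) ` ball (0::complex) 1 \<subseteq> ball 0 1" using sq by blast
    from holomorphic_on_compose_gen[OF holomorphic_on_power[OF holomorphic_on_ident] e(1) this]
    show ?thesis by (simp add: o_def)
  qed
  have u_inj: "inj_on (\<lambda>z. e (z\<^sup>2) / z) (ball 0 1 - {0})"
  proof (rule inj_onI)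
    fix z w assume z: "z \<in> ball 0 1 - {0}" and w: "w \<in> ball 0 1 - {0}" and eq: "e (z\<^sup>2) / z = e (w\<^sup>2) / w"
    \<comment> \<open>The squared values determine \<open>f (x\<^sup>2)\<close>, hence
      \<open>x\<^sup>2\<close>; the unsquared values then exclude \<open>z = - w\<close>.\<close>
    have inv: "(e (x\<^sup>2) / x)\<^sup>2 * f (x\<^sup>2) = 1" if "x \<in> ball 0 1 - {0}" for x
      using e(3)[OF sq, of x] that by (simp add: power_divide)
    have "f (z\<^sup>2) = f (w\<^sup>2)"
      using inv[OF z] inv[OF w] unfolding eq by (metis mult_cancel_left zero_neq_one mult_zero_left)
    then have zw: "z\<^sup>2 = w\<^sup>2" using inj_onD[OF f(2)] sq z w by auto
    have "e (w\<^sup>2) \<noteq> 0" using inv[OF w] by auto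
    then show "z = w" using eq unfolding zw using z w by (auto simp: field_simps)
  qed
  have U_nth: "fps_nth U (2 * n) = fps_nth E n" for n
    by (simp add: U_def fps_nth_compose_X_power)
  have "(\<Sum>n\<le>8. (real n - 1) * (norm (fps_nth U n))\<^sup>2) \<le> 0"
    using U_nth[of 0] E0 by (intro area_theorem[OF u_hol U u_inj]) simp
  \<comment> \<open>These indices carry the coefficients 0, 1, 2, 4 of \<open>E\<close> with weights
    -1, 1, 3, 7. The only negative weight is kept, so omitting the rest decreases the sum.\<close>
  moreover have "(\<Sum>n\<in>{0,2,4,8}. (real n - 1) * (norm (fps_nth U n))\<^sup>2) \<le> (\<Sum>n\<le>8. (real n - 1) * (norm (fps_nth U n))\<^sup>2)"
    by (rule sum_mono2) auto
  ultimately have "(\<Sum>n\<in>{0,2,4,8}. (real n - 1) * (norm (fps_nth U n))\<^sup>2) \<le> 0" by linarith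
  then have area: "(norm (fps_nth E 1))\<^sup>2 + 3 * (norm (fps_nth E 2))\<^sup>2 + 7 * (norm (fps_nth E 4))\<^sup>2 \<le> 1"
    using U_nth[of 0] U_nth[of 1] U_nth[of 2] U_nth[of 4] E0 by simp
  define x y t where xyt: "x = norm (fps_nth E 1)" "y = norm (fps_nth E 2)" "t = norm (fps_nth E 4)"
  have area': "x\<^sup>2 + 3 * y\<^sup>2 + 7 * t\<^sup>2 \<le> 1" using area by (simp add: xyt)
  have x1: "x\<^sup>2 \<le> 1" using area' zero_le_power2[of y] zero_le_power2[of t] by linarith
  then have x1': "x \<le> 1" by (simp add: abs_square_le_1)
  have "gamma4 f = - (fps_nth E 1 * gamma3 f) + (- fps_nth E 4 + (fps_nth E 2)\<^sup>2 / 2 - fps_nth E 1 ^ 4 / 12)"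
    using gamma_via_inverse_sqrt[OF EF E0 F0, of f] by (simp add: F_def fps_expansion_def tcoeff_def algebra_simps)
  also have "norm \<dots> \<le> norm (fps_nth E 1 * gamma3 f) + (norm (fps_nth E 4) + norm ((fps_nth E 2)\<^sup>2 / 2) + norm (fps_nth E 1 ^ 4 / 12))"
    by (rule order_trans[OF norm_triangle_ineq]) 
       (intro add_mono order_trans[OF norm_triangle_ineq4] order_trans[OF norm_triangle_ineq]; simp)
  also have "\<dots> = x * norm (gamma3 f) + (t + y\<^sup>2 / 2 + x ^ 4 / 12)"
    by (simp add: xyt norm_mult norm_power norm_divide)
  also have "\<dots> \<le> 1 * norm (gamma3 f) + 1 / sqrt 7"
  proof (intro add_mono mult_right_mono x1')
    define s where "s = sqrt 7"
    have s: "s\<^sup>2 = 7" "0 < s" "s \<le> 3" by (auto simp: s_def real_le_lsqrt)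
    \<comment> \<open>The bound for \<open>t\<close> is sharp at \<open>t = 1 / sqrt 7\<close>,
      where the area inequality forces \<open>x = y = 0\<close>. Together the three estimates give
      at most half of \<open>x\<^sup>2 + 3 * y\<^sup>2 + 7 * t\<^sup>2 + 1\<close>.\<close>
    have "0 \<le> (s * t - 1)\<^sup>2" by simp
    then have "2 * (s * t) \<le> 7 * t\<^sup>2 + 1"
      unfolding power2_diff power_mult_distrib s(1) by simp
    moreover have "s * y\<^sup>2 \<le> 3 * y\<^sup>2" using s by (intro mult_right_mono) auto
    moreover have "s * x ^ 4 \<le> 3 * x\<^sup>2"
    proof -
      have "x\<^sup>2 * x\<^sup>2 \<le> x\<^sup>2 * 1" using x1 by (intro mult_left_mono) auto
      then have "x ^ 4 \<le> x\<^sup>2" by (simp add: power2_eq_square power4_eq_xxxx mult_ac)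
      then show ?thesis using s by (intro mult_mono) auto
    qed
    ultimately have "s * t + s * y\<^sup>2 / 2 + s * x ^ 4 / 12 \<le> 1"
      using area' zero_le_power2[of x] by linarith
    then have "s * (t + y\<^sup>2 / 2 + x ^ 4 / 12) \<le> 1"
      by (simp add: distrib_left)
    then show "t + y\<^sup>2 / 2 + x ^ 4 / 12 \<le> 1 / sqrt 7"
      using s(2) by (simp add: s_def[symmetric] field_simps)
  qed simp
  finally show ?thesis by simp
qed
end
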